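(* Let $\mu$ and $\nu$ be two constants with $0<\mu<\nu$. Then (1) $\mathcal{B}(\nu)\subsetneq\mathcal{B}_H(\nu)\subsetneq\mathcal{B}^*_H(\nu)$; (2) $\mathcal{B}(\mu)\subsetneq\mathcal{B}(\nu)$, $\mathcal{B}_H(\mu)\subsetneq\mathcal{B}_H(\nu)$ and $\mathcal{B}^*_H(\mu)\subsetneq\mathcal{B}^*_H(\nu)$.
   Context: $\mathbb{D}$ is the open unit disk in $\mathbb{C}$. A harmonic mapping in $\mathbb{D}$ is a complex-valued $f$ with $f_{z\overline z}=0$; its canonical decomposition is $f=h+\overline g$ with $h,g$ analytic in $\mathbb{D}$, $g(0)=0$. Its Jacobian is $J_f=|h'|^2-|g'|^2$. For $\nu>0$: $\mathcal{B}_H(\nu)$ is the set of harmonic mappings $f=h+\overline g$ in $\mathbb{D}$ with $\sup_{z\in\mathbb{D}}(1-|z|^2)^\nu(|h'(z)|+|g'(z)|)<\infty$; $\mathcal{B}(\nu)$ is the set of those $f\in\mathcal{B}_H(\nu)$ with $g\equiv0$ (analytic $f$); $\mathcal{B}^*_H(\nu)$ is the set of harmonic mappings $f$ in $\mathbb{D}$ with $\sup_{z\in\mathbb{D}}(1-|z|^2)^\nu\sqrt{|J_f(z)|}<\infty$. *)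

theory Defs
  imports "HOL-Complex_Analysis.Complex_Analysis"
begin

text \<open>Functions on the unit disk are total functions on the complex numbers; every notion below
  depends only on the values on \<^term>\<open>ball (0::complex) 1\<close>.\<close>

definition dir_deriv :: "complex \<Rightarrow> (complex \<Rightarrow> complex) \<Rightarrow> complex \<Rightarrow> complex" where
  "dir_deriv v f z = frechet_derivative f (at z) v"

definition wirtinger :: "(complex \<Rightarrow> complex) \<Rightarrow> complex \<Rightarrow> complex" where
  "wirtinger f z = (dir_deriv 1 f z - \<i> * dir_deriv \<i> f z) / 2"

definition wirtinger_bar :: "(complex \<Rightarrow> complex) \<Rightarrow> complex \<Rightarrow> complex" where
  "wirtinger_bar f z = (dir_deriv 1 f z + \<i> * dir_deriv \<i> f z) / 2"

text \<open>Twice continuously differentiable in the real sense (the directions \<open>1\<close> and \<open>\<i>\<close> give the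
  partial derivatives in \<open>x\<close> and \<open>y\<close>); this is the regularity under which the equation for the
  mixed Wirtinger derivative is understood.\<close>

definition C2_on :: "complex set \<Rightarrow> (complex \<Rightarrow> complex) \<Rightarrow> bool" where
  "C2_on S f \<longleftrightarrow>
     (\<forall>z\<in>S. f differentiable (at z)) \<and>
     (\<forall>v\<in>{1, \<i>}. \<forall>z\<in>S. dir_deriv v f differentiable (at z)) \<and>
     (\<forall>v\<in>{1, \<i>}. \<forall>w\<in>{1, \<i>}. continuous_on S (dir_deriv w (dir_deriv v f)))"

definition harmonic_mapping :: "(complex \<Rightarrow> complex) \<Rightarrow> bool" where
  "harmonic_mapping f \<longleftrightarrow>
     C2_on (ball 0 1) f \<and> (\<forall>z\<in>ball 0 1. wirtinger_bar (wirtinger f) z = 0)"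

text \<open>On the disk, the pair \<open>h\<close>, \<open>g\<close> is uniquely determined by \<open>f\<close>, so it does not matter which
  pair is picked by the existential quantifiers below.\<close>

definition canonical_decomposition ::
    "(complex \<Rightarrow> complex) \<Rightarrow> (complex \<Rightarrow> complex) \<Rightarrow> (complex \<Rightarrow> complex) \<Rightarrow> bool" where
  "canonical_decomposition f h g \<longleftrightarrow>
     h holomorphic_on ball 0 1 \<and> g holomorphic_on ball 0 1 \<and> g 0 = 0 \<and>
     (\<forall>z\<in>ball 0 1. f z = h z + cnj (g z))"

definition harmonic_Bloch :: "real \<Rightarrow> (complex \<Rightarrow> complex) set" where
  "harmonic_Bloch \<nu> = {f. harmonic_mapping f \<and>
     (\<exists>h g. canonical_decomposition f h g \<and>
        bdd_above ((\<lambda>z. (1 - (cmod z)\<^sup>2) powr \<nu> * (cmod (deriv h z) + cmod (deriv g z)))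
          ` ball 0 1))}"

definition analytic_Bloch :: "real \<Rightarrow> (complex \<Rightarrow> complex) set" where
  "analytic_Bloch \<nu> = {f \<in> harmonic_Bloch \<nu>.
     \<exists>h g. canonical_decomposition f h g \<and> (\<forall>z\<in>ball 0 1. g z = 0)}"

definition jacobian :: "(complex \<Rightarrow> complex) \<Rightarrow> (complex \<Rightarrow> complex) \<Rightarrow> complex \<Rightarrow> real" where
  "jacobian h g z = (cmod (deriv h z))\<^sup>2 - (cmod (deriv g z))\<^sup>2"

definition Bloch_type :: "real \<Rightarrow> (complex \<Rightarrow> complex) set" where
  "Bloch_type \<nu> = {f. harmonic_mapping f \<and>
     (\<exists>h g. canonical_decomposition f h g \<and>
        bdd_above ((\<lambda>z. (1 - (cmod z)\<^sup>2) powr \<nu> * sqrt \<bar>jacobian h g z\<bar>) ` ball 0 1))}"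

end

theory Submission
  imports Defs
begin

text \<open>The Bloch conditions can be read off any canonical decomposition, since the decomposition is
  unique and every function that has one is harmonic. The inclusions are then pointwise inequalities.
  Strictness comes from the functions \<open>P\<^sub>a\<close> with \<open>P\<^sub>a'(z) = (1 - z)\<^sup>-\<^sup>a\<close> and \<open>P\<^sub>a(0) = 0\<close>:
  the weight \<open>(1 - |z|\<^sup>2)\<^sup>\<nu>\<close> makes this derivative bounded for \<open>a = \<nu>\<close> and unbounded for \<open>a > \<nu>\<close>.
  \<open>P\<^sub>\<nu>\<close> separates the exponents \<open>\<mu> < \<nu>\<close> in all three scales, \<open>P\<^sub>a + cnj P\<^sub>a\<close> with \<open>a > \<nu>\<close>
  has vanishing Jacobian but is not harmonic Bloch, and \<open>cnj z\<close> is harmonic Bloch but not analytic.\<close>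

section \<open>Real derivatives of sums of analytic and conjugate-analytic functions\<close>

lemma canonical_decomposition_has_derivative:
  assumes "h holomorphic_on ball 0 1" "g holomorphic_on ball 0 1"
    and "\<forall>z\<in>ball 0 1. f z = h z + cnj (g z)" and z: "z \<in> ball 0 1"
  shows "(f has_derivative (\<lambda>v. deriv h z * v + cnj (deriv g z * v))) (at z)"
proof -
  have h: "(h has_derivative (\<lambda>v. deriv h z * v)) (at z)"
    using holomorphic_derivI[OF assms(1) open_ball z] by (simp add: has_field_derivative_def)
  have g: "(g has_derivative (\<lambda>v. deriv g z * v)) (at z)"
    using holomorphic_derivI[OF assms(2) open_ball z] by (simp add: has_field_derivative_def)
  have "((\<lambda>z. h z + cnj (g z)) has_derivative (\<lambda>v. deriv h z * v + cnj (deriv g z * v))) (at z)"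
    by (intro has_derivative_add h has_derivative_cnj g)
  then show ?thesis
    by (rule has_derivative_transform_within_open[OF _ open_ball z]) (use assms(3) in auto)
qed

text \<open>A directional derivative is again analytic plus conjugate-analytic, so this rule can be
  applied to its own conclusion to reach second derivatives. The hypotheses do not use
  \<open>canonical_decomposition\<close>, since \<open>v * deriv g z\<close> may be nonzero at
  0.\<close>

lemma dir_deriv_decomposition:
  assumes "h holomorphic_on ball 0 1" "g holomorphic_on ball 0 1"
    and "\<forall>z\<in>ball 0 1. f z = h z + cnj (g z)"
  shows "\<forall>z\<in>ball 0 1. dir_deriv v f z = v * deriv h z + cnj (v * deriv g z)"
  unfolding dir_deriv_def
  using frechet_derivative_at[OF canonical_decomposition_has_derivative[OF assms], symmetric]
  by (simp add: mult.commute)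

lemma decomposition_differentiable:
  assumes "h holomorphic_on ball 0 1" "g holomorphic_on ball 0 1"
    and "\<forall>z\<in>ball 0 1. f z = h z + cnj (g z)" and "z \<in> ball 0 1"
  shows "f differentiable at z"
  using canonical_decomposition_has_derivative[OF assms] by (rule differentiableI)

lemma canonical_decomposition_imp_harmonic:
  assumes "canonical_decomposition f h g"
  shows "harmonic_mapping f"
proof -
  have h: "h holomorphic_on ball 0 1" and g: "g holomorphic_on ball 0 1"
    and f: "\<forall>z\<in>ball 0 1. f z = h z + cnj (g z)"
    using assms by (auto simp: canonical_decomposition_def)
  have hol1: "(\<lambda>z. v * deriv h z) holomorphic_on ball 0 1"
    "(\<lambda>z. v * deriv g z) holomorphic_on ball 0 1" for v
    by (intro holomorphic_intros holomorphic_deriv h g open_ball)+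
  note d1 = dir_deriv_decomposition[OF h g f]
  have d2: "dir_deriv v f differentiable at z" if "z \<in> ball 0 1" for v z
    using decomposition_differentiable[OF hol1 d1 that] .
  have hol2: "(\<lambda>z. w * deriv (\<lambda>z. v * deriv h z) z) holomorphic_on ball 0 1"
    "(\<lambda>z. w * deriv (\<lambda>z. v * deriv g z) z) holomorphic_on ball 0 1" for v w
    by (intro holomorphic_intros holomorphic_deriv hol1 open_ball)+
  have d3: "dir_deriv w (dir_deriv v f) differentiable at z" if "z \<in> ball 0 1" for v w z
    using decomposition_differentiable[OF hol2 dir_deriv_decomposition[OF hol1 d1] that] .
  have "C2_on (ball 0 1) f"
    unfolding C2_on_def
    using decomposition_differentiable[OF h g f] d2 d3
    by (auto intro!: continuous_at_imp_continuous_on differentiable_imp_continuous_within)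
  moreover have "wirtinger_bar (wirtinger f) z = 0" if z: "z \<in> ball 0 1" for z
  proof -
    \<comment> \<open>The contributions of \<open>cnj (deriv g z)\<close> from the directions 1 and
      \<open>\<i>\<close> cancel. The term \<open>cnj 0\<close> puts the result in the shape that
      \<open>dir_deriv_decomposition\<close> expects, with zero conjugate part.\<close>
    have w: "\<forall>z\<in>ball 0 1. wirtinger f z = deriv h z + cnj 0"
      using d1 by (auto simp: wirtinger_def algebra_simps)
    have "deriv h holomorphic_on ball 0 1"
      using h by (rule holomorphic_deriv) simp
    from dir_deriv_decomposition[OF this holomorphic_on_const w] z
    show ?thesis by (simp add: wirtinger_bar_def)
  qed
  ultimately show ?thesis by (simp add: harmonic_mapping_def)
qed

text \<open>The real differential of f at a point determines both complex coefficients, so the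
  derivatives agree; the normalisation at 0 then fixes the constant of integration.\<close>

lemma canonical_decomposition_unique:
  assumes 1: "canonical_decomposition f h1 g1" and 2: "canonical_decomposition f h2 g2"
    and z: "z \<in> ball 0 1"
  shows "h1 z = h2 z" "g1 z = g2 z" "deriv h1 z = deriv h2 z" "deriv g1 z = deriv g2 z"
proof -
  have hol: "h1 holomorphic_on ball 0 1" "g1 holomorphic_on ball 0 1"
    "h2 holomorphic_on ball 0 1" "g2 holomorphic_on ball 0 1"
    and f1: "\<forall>z\<in>ball 0 1. f z = h1 z + cnj (g1 z)"
    and f2: "\<forall>z\<in>ball 0 1. f z = h2 z + cnj (g2 z)"
    and 0: "g1 0 = 0" "g2 0 = 0"
    using 1 2 by (auto simp: canonical_decomposition_def)
  have d: "deriv h1 w = deriv h2 w \<and> deriv g1 w = deriv g2 w" if "w \<in> ball 0 1" for w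
  proof -
    have "v * deriv h1 w + cnj (v * deriv g1 w) = v * deriv h2 w + cnj (v * deriv g2 w)" for v
      using dir_deriv_decomposition[OF hol(1,2) f1, of v]
        dir_deriv_decomposition[OF hol(3,4) f2, of v] that by simp
    \<comment> \<open>With coefficients a and b, the direction 1 gives a + cnj b, and
      \<open>\<i>\<close> gives \<open>\<i>\<close> times a - cnj b.\<close>
    from this[of 1] this[of \<i>] show ?thesis
      by (auto simp: complex_eq_iff)
  qed
  have "((\<lambda>z. g1 z - g2 z) has_field_derivative 0) (at w within ball 0 1)" if "w \<in> ball 0 1" for w
    using DERIV_diff[OF holomorphic_derivI[OF hol(2) open_ball that]
        holomorphic_derivI[OF hol(4) open_ball that]] d[OF that]
    by simp
  from has_field_derivative_zero_constant[OF convex_ball this]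
  obtain c where c: "\<And>z. z \<in> ball 0 1 \<Longrightarrow> g1 z - g2 z = c" by blast
  from c[of 0] 0 have "c = 0" by simp
  with c z show "g1 z = g2 z" by force
  then show "h1 z = h2 z" using bspec[OF f1 z] bspec[OF f2 z] by simp
  show "deriv h1 z = deriv h2 z" "deriv g1 z = deriv g2 z" using d z by auto
qed

section \<open>Membership tested on an arbitrary decomposition\<close>

lemma harmonic_Bloch_iff:
  assumes "canonical_decomposition f h g"
  shows "f \<in> harmonic_Bloch \<nu> \<longleftrightarrow>
    bdd_above ((\<lambda>z. (1 - (cmod z)\<^sup>2) powr \<nu> * (cmod (deriv h z) + cmod (deriv g z))) ` ball 0 1)"
    (is "_ \<longleftrightarrow> bdd_above (?F h g ` _)")
proof
  assume "f \<in> harmonic_Bloch \<nu>"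
  then obtain h' g' where *: "canonical_decomposition f h' g'" "bdd_above (?F h' g' ` ball 0 1)"
    by (auto simp: harmonic_Bloch_def)
  have "?F h' g' ` ball 0 1 = ?F h g ` ball 0 1"
    using canonical_decomposition_unique[OF *(1) assms] by (intro image_cong) simp_all
  with * show "bdd_above (?F h g ` ball 0 1)" by simp
next
  assume "bdd_above (?F h g ` ball 0 1)"
  with assms canonical_decomposition_imp_harmonic[OF assms] show "f \<in> harmonic_Bloch \<nu>"
    unfolding harmonic_Bloch_def by blast
qed

lemma Bloch_type_iff:
  assumes "canonical_decomposition f h g"
  shows "f \<in> Bloch_type \<nu> \<longleftrightarrow>
    bdd_above ((\<lambda>z. (1 - (cmod z)\<^sup>2) powr \<nu> * sqrt \<bar>jacobian h g z\<bar>) ` ball 0 1)"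
    (is "_ \<longleftrightarrow> bdd_above (?F h g ` _)")
proof
  assume "f \<in> Bloch_type \<nu>"
  then obtain h' g' where *: "canonical_decomposition f h' g'" "bdd_above (?F h' g' ` ball 0 1)"
    by (auto simp: Bloch_type_def)
  have "?F h' g' ` ball 0 1 = ?F h g ` ball 0 1"
    using canonical_decomposition_unique[OF *(1) assms]
    by (intro image_cong) (simp_all add: jacobian_def)
  with * show "bdd_above (?F h g ` ball 0 1)" by simp
next
  assume "bdd_above (?F h g ` ball 0 1)"
  with assms canonical_decomposition_imp_harmonic[OF assms] show "f \<in> Bloch_type \<nu>"
    unfolding Bloch_type_def by blast
qed

lemma analytic_Bloch_iff:
  assumes "canonical_decomposition f h g"
  shows "f \<in> analytic_Bloch \<nu> \<longleftrightarrow> f \<in> harmonic_Bloch \<nu> \<and> (\<forall>z\<in>ball 0 1. g z = 0)"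
proof -
  have "\<forall>z\<in>ball 0 1. g z = 0"
    if "canonical_decomposition f h' g'" "\<forall>z\<in>ball 0 1. g' z = 0" for h' g'
    using canonical_decomposition_unique(2)[OF assms that(1)] that(2) by metis
  then show ?thesis
    using assms unfolding analytic_Bloch_def by blast
qed

section \<open>Pointwise inequalities and the inclusions\<close>

lemma bdd_above_image_mono:
  fixes F G :: "'a \<Rightarrow> 'b::preorder"
  assumes "bdd_above (G ` A)" and "\<And>x. x \<in> A \<Longrightarrow> F x \<le> G x"
  shows "bdd_above (F ` A)"
  using assms unfolding bdd_above_def by (auto intro: order_trans)

text \<open>The base lies in the interval from 0 to 1, where a larger exponent gives a smaller
  power.\<close>

lemma weight_antimono:
  fixes z :: complex
  assumes "z \<in> ball 0 1" and "\<mu> \<le> \<nu>"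
  shows "(1 - (cmod z)\<^sup>2) powr \<nu> \<le> (1 - (cmod z)\<^sup>2) powr \<mu>"
  using assms by (intro powr_mono') (auto simp: power_le_one)

lemma harmonic_Bloch_mono:
  assumes "\<mu> \<le> \<nu>"
  shows "harmonic_Bloch \<mu> \<subseteq> harmonic_Bloch \<nu>"
proof
  fix f assume f: "f \<in> harmonic_Bloch \<mu>"
  then obtain h g where d: "canonical_decomposition f h g"
    by (auto simp: harmonic_Bloch_def)
  show "f \<in> harmonic_Bloch \<nu>"
    using f unfolding harmonic_Bloch_iff[OF d]
    by (rule bdd_above_image_mono) (intro mult_right_mono weight_antimono assms, auto)
qed

lemma Bloch_type_mono:
  assumes "\<mu> \<le> \<nu>"
  shows "Bloch_type \<mu> \<subseteq> Bloch_type \<nu>"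
proof
  fix f assume f: "f \<in> Bloch_type \<mu>"
  then obtain h g where d: "canonical_decomposition f h g"
    by (auto simp: Bloch_type_def)
  show "f \<in> Bloch_type \<nu>"
    using f unfolding Bloch_type_iff[OF d]
    by (rule bdd_above_image_mono) (intro mult_right_mono weight_antimono assms, auto)
qed

lemma sqrt_jacobian_le: "sqrt \<bar>jacobian h g z\<bar> \<le> cmod (deriv h z) + cmod (deriv g z)"
proof (rule real_le_lsqrt)
  \<comment> \<open>The cross term 2xy is nonnegative, so the right side is at least the sum of the
    squares.\<close>
  have "\<bar>x\<^sup>2 - y\<^sup>2\<bar> \<le> (x + y)\<^sup>2" if "x \<ge> 0" "y \<ge> 0" for x y :: real
    using mult_nonneg_nonneg[OF that] by (auto simp: abs_le_iff power2_sum)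
  then show "\<bar>jacobian h g z\<bar> \<le> (cmod (deriv h z) + cmod (deriv g z))\<^sup>2"
    by (simp add: jacobian_def)
qed auto

lemma harmonic_Bloch_subset_Bloch_type: "harmonic_Bloch \<nu> \<subseteq> Bloch_type \<nu>"
proof
  fix f assume f: "f \<in> harmonic_Bloch \<nu>"
  then obtain h g where d: "canonical_decomposition f h g"
    by (auto simp: harmonic_Bloch_def)
  show "f \<in> Bloch_type \<nu>"
    using f unfolding harmonic_Bloch_iff[OF d] Bloch_type_iff[OF d]
    by (rule bdd_above_image_mono) (intro mult_left_mono sqrt_jacobian_le, auto)
qed

section \<open>Primitives of powers of 1 - z and their weighted growth\<close>

lemma power_singularity_primitive:
  fixes a :: real
  obtains P where "P holomorphic_on ball 0 1" "P 0 = 0"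
    "\<And>z. z \<in> ball 0 1 \<Longrightarrow> cmod (deriv P z) = cmod (1 - z) powr (-a)"
proof -
  \<comment> \<open>The principal branch is analytic here because 1 - z has positive real part on
    the disk. As a is real, the modulus of p depends only on that of 1 - z.\<close>
  define p where "p z = exp (- of_real a * Ln (1 - z))" for z
  have Re: "Re z < 1" if "z \<in> ball 0 1" for z
    using that complex_Re_le_cmod[of z] by simp
  have "p holomorphic_on ball 0 1"
    unfolding p_def using Re by (intro holomorphic_intros) (force simp: complex_nonpos_Reals_iff)
  from holomorphic_convex_primitive'[OF convex_ball open_ball this]
  obtain Q where Q: "\<And>z. z \<in> ball 0 1 \<Longrightarrow> (Q has_field_derivative p z) (at z within ball 0 1)"
    by blast
  \<comment> \<open>Vanishing at 0 lets P also serve as the conjugated part of a canonical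
    decomposition.\<close>
  define P where "P z = Q z - Q 0" for z
  have P: "(P has_field_derivative p z) (at z)" if "z \<in> ball 0 1" for z
    using DERIV_diff[OF Q[OF that] DERIV_const[of "Q 0"]] at_within_open[OF that open_ball]
    by (simp add: P_def[abs_def])
  show thesis
  proof
    show "P holomorphic_on ball 0 1"
      unfolding holomorphic_on_open[OF open_ball] using P by blast
    show "P 0 = 0" by (simp add: P_def)
    fix z :: complex assume z: "z \<in> ball 0 1"
    then have "1 - z \<noteq> 0" using Re[OF z] by auto
    then show "cmod (deriv P z) = cmod (1 - z) powr (-a)"
      using DERIV_imp_deriv[OF P[OF z]] by (simp add: p_def powr_def)
  qed
qed

lemma weighted_singularity_bounded:
  fixes \<nu> :: real
  assumes "0 < \<nu>"
  shows "bdd_above ((\<lambda>z. (1 - (cmod z)\<^sup>2) powr \<nu> * cmod (1 - z) powr (-\<nu>)) ` ball 0 1)"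
proof (rule bdd_aboveI2)
  fix z :: complex assume "z \<in> ball 0 1"
  then have z: "cmod z < 1" by simp
  have le: "1 - cmod z \<le> cmod (1 - z)"
    using norm_triangle_ineq2[of 1 z] by simp
  have pos: "cmod (1 - z) > 0" using le z by linarith
  have "1 - (cmod z)\<^sup>2 = (1 + cmod z) * (1 - cmod z)"
    by (simp add: power2_eq_square algebra_simps)
  also have "\<dots> \<le> 2 * cmod (1 - z)"
    using z le by (intro mult_mono) auto
  finally have "(1 - (cmod z)\<^sup>2) powr \<nu> \<le> (2 * cmod (1 - z)) powr \<nu>"
    using assms z by (intro powr_mono2) (auto simp: power_le_one)
  also have "\<dots> = 2 powr \<nu> * cmod (1 - z) powr \<nu>"
    by (simp add: powr_mult)
  finally have "(1 - (cmod z)\<^sup>2) powr \<nu> * cmod (1 - z) powr (-\<nu>)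
      \<le> 2 powr \<nu> * cmod (1 - z) powr \<nu> * cmod (1 - z) powr (-\<nu>)"
    by (rule mult_right_mono) simp
  also have "\<dots> = 2 powr \<nu>" using pos by (simp add: powr_minus)
  finally show "(1 - (cmod z)\<^sup>2) powr \<nu> * cmod (1 - z) powr (-\<nu>) \<le> 2 powr \<nu>" .
qed

text \<open>On the radius z = 1 - t the weight base is at least t, so the product is at least
  \<open>t powr (\<mu> - a)\<close>, which blows up as t tends to 0.\<close>

lemma weighted_singularity_unbounded:
  fixes \<mu> a :: real
  assumes "0 < \<mu>" "\<mu> < a"
  shows "\<not> bdd_above ((\<lambda>z. (1 - (cmod z)\<^sup>2) powr \<mu> * cmod (1 - z) powr (-a)) ` ball 0 1)"
proof
  assume "bdd_above ((\<lambda>z. (1 - (cmod z)\<^sup>2) powr \<mu> * cmod (1 - z) powr (-a)) ` ball 0 1)"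
  then obtain M
    where M: "\<And>z. z \<in> ball 0 1 \<Longrightarrow> (1 - (cmod z)\<^sup>2) powr \<mu> * cmod (1 - z) powr (-a) \<le> M"
    unfolding bdd_above_def by blast
  \<comment> \<open>K exceeds the supposed bound, and K > 1 forces t < 1 below; t is the solution of
    \<open>t powr (\<mu> - a) = K\<close>.\<close>
  define K where "K = max M 1 + 1"
  have K: "K > 1" "K > M" by (auto simp: K_def)
  define t where "t = K powr (-1 / (a - \<mu>))"
  have t: "0 < t" "t < 1"
    using K assms powr_less_mono[of "-1 / (a - \<mu>)" 0 K] by (auto simp: t_def)
  let ?z = "complex_of_real (1 - t)"
  have "1 - ?z = of_real t" by simp
  then have norms: "cmod ?z = 1 - t" "cmod (1 - ?z) = t"
    using t by (simp_all only: norm_of_real)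
  have "t * t \<le> t * 1" using t by (intro mult_left_mono) auto
  then have "t \<le> 1 - (1 - t)\<^sup>2"
    by (simp add: power2_eq_square algebra_simps)
  then have "t powr \<mu> * t powr (-a) \<le> (1 - (1 - t)\<^sup>2) powr \<mu> * t powr (-a)"
    using t assms by (intro mult_right_mono powr_mono2) auto
  also have "\<dots> \<le> M" using M[of ?z] t unfolding mem_ball_0 norms by simp
  finally have "t powr (\<mu> - a) \<le> M" using powr_add[of t \<mu> "-a"] by simp
  moreover have "t powr (\<mu> - a) = K"
  proof -
    have "-1 / (a - \<mu>) * (\<mu> - a) = 1" using assms by (simp add: field_simps)
    then show ?thesis using K by (simp add: t_def powr_powr)
  qed
  ultimately show False using K by simp
qed

theorem proposition2:
  fixes \<mu> \<nu> :: real
  assumes "0 < \<mu>" and "\<mu> < \<nu>"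
  shows "(analytic_Bloch \<nu> \<subset> harmonic_Bloch \<nu> \<and> harmonic_Bloch \<nu> \<subset> Bloch_type \<nu>) \<and>
         (analytic_Bloch \<mu> \<subset> analytic_Bloch \<nu> \<and>
          harmonic_Bloch \<mu> \<subset> harmonic_Bloch \<nu> \<and>
          Bloch_type \<mu> \<subset> Bloch_type \<nu>)"
proof -
  have \<nu>: "0 < \<nu>" using assms by simp
  have 1: "\<exists>f. f \<in> harmonic_Bloch \<nu> \<and> f \<notin> analytic_Bloch \<nu>"
  proof (intro exI conjI)
    have d: "canonical_decomposition cnj (\<lambda>z. 0) (\<lambda>z. z)"
      by (auto simp: canonical_decomposition_def)
    show "cnj \<in> harmonic_Bloch \<nu>"
      unfolding harmonic_Bloch_iff[OF d]
      by (rule bdd_aboveI2[where M = 1]) (use \<nu> in \<open>auto intro!: powr_le1 simp: power_le_one\<close>)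
    \<comment> \<open>A point of the disk where the conjugated part, here the identity, does not
      vanish.\<close>
    have "(1/2 :: complex) \<in> ball 0 1" "(1/2 :: complex) \<noteq> 0" by auto
    then show "cnj \<notin> analytic_Bloch \<nu>"
      unfolding analytic_Bloch_iff[OF d] by blast
  qed
  have 2: "\<exists>f. f \<in> Bloch_type \<nu> \<and> f \<notin> harmonic_Bloch \<nu>"
  proof -
    \<comment> \<open>Any exponent above \<nu> would do. Taking P for both parts cancels the
      Jacobian but doubles the modulus of the derivative in the harmonic Bloch condition.\<close>
    obtain P where P: "P holomorphic_on ball 0 1" "P 0 = 0"
      "\<And>z. z \<in> ball 0 1 \<Longrightarrow> cmod (deriv P z) = cmod (1 - z) powr (-(\<nu> + 1))"
      by (rule power_singularity_primitive) blast
    have d: "canonical_decomposition (\<lambda>z. P z + cnj (P z)) P P"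
      using P by (simp add: canonical_decomposition_def)
    have "(\<lambda>z. P z + cnj (P z)) \<in> Bloch_type \<nu>"
      unfolding Bloch_type_iff[OF d] by (rule bdd_aboveI2[where M = 0]) (simp add: jacobian_def)
    moreover have "(\<lambda>z. P z + cnj (P z)) \<notin> harmonic_Bloch \<nu>"
    proof
      assume "(\<lambda>z. P z + cnj (P z)) \<in> harmonic_Bloch \<nu>"
      then have "bdd_above ((\<lambda>z. (1 - (cmod z)\<^sup>2) powr \<nu> * cmod (1 - z) powr (-(\<nu> + 1))) ` ball 0 1)"
        unfolding harmonic_Bloch_iff[OF d]
        by (rule bdd_above_image_mono) (intro mult_left_mono, simp_all add: P(3))
      with weighted_singularity_unbounded[OF \<nu>, of "\<nu> + 1"] show False by simp
    qed
    ultimately show ?thesis by blast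
  qed
  \<comment> \<open>The critical exponent \<nu> is bounded at weight \<nu> and unbounded at weight
    \<mu>. With zero conjugate part the three membership conditions coincide, so this one P settles
    all of (2).\<close>
  obtain P where P: "P holomorphic_on ball 0 1" "P 0 = 0"
    "\<And>z. z \<in> ball 0 1 \<Longrightarrow> cmod (deriv P z) = cmod (1 - z) powr (-\<nu>)"
    by (rule power_singularity_primitive) blast
  have d: "canonical_decomposition P P (\<lambda>z. 0)"
    using P by (simp add: canonical_decomposition_def)
  have P_harmonic: "P \<in> harmonic_Bloch \<kappa> \<longleftrightarrow>
      bdd_above ((\<lambda>z. (1 - (cmod z)\<^sup>2) powr \<kappa> * cmod (1 - z) powr (-\<nu>)) ` ball 0 1)" for \<kappa>
    unfolding harmonic_Bloch_iff[OF d]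
    by (rule arg_cong[where f = bdd_above], rule image_cong) (simp_all add: P(3))
  have P_type: "P \<in> Bloch_type \<kappa> \<longleftrightarrow> P \<in> harmonic_Bloch \<kappa>" for \<kappa>
    unfolding Bloch_type_iff[OF d] harmonic_Bloch_iff[OF d] by (simp add: jacobian_def)
  have P_analytic: "P \<in> analytic_Bloch \<kappa> \<longleftrightarrow> P \<in> harmonic_Bloch \<kappa>" for \<kappa>
    unfolding analytic_Bloch_iff[OF d] by simp
  have 3: "P \<in> harmonic_Bloch \<nu>" "P \<notin> harmonic_Bloch \<mu>"
    unfolding P_harmonic
    using weighted_singularity_bounded[OF \<nu>] weighted_singularity_unbounded[OF assms] by auto
  have "analytic_Bloch \<kappa> \<subseteq> harmonic_Bloch \<kappa>" for \<kappa>
    by (auto simp: analytic_Bloch_def)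
  moreover have "analytic_Bloch \<mu> \<subseteq> analytic_Bloch \<nu>"
    using harmonic_Bloch_mono[of \<mu> \<nu>] assms by (auto simp: analytic_Bloch_def)
  moreover have "harmonic_Bloch \<mu> \<subseteq> harmonic_Bloch \<nu>" "Bloch_type \<mu> \<subseteq> Bloch_type \<nu>"
    using harmonic_Bloch_mono[of \<mu> \<nu>] Bloch_type_mono[of \<mu> \<nu>] assms by auto
  moreover have "P \<in> analytic_Bloch \<nu>" "P \<notin> analytic_Bloch \<mu>" "P \<in> Bloch_type \<nu>" "P \<notin> Bloch_type \<mu>"
    using 3 P_type P_analytic by auto
  ultimately show ?thesis
    using 1 2 3 harmonic_Bloch_subset_Bloch_type[of \<nu>] by blast
qed

end
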